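(* Let $\{\lambda_k\}_{k\ge 1}\subset\mathbb{D}$ be a sequence in the unit disk and let $m_k,M_k>0$, $k\geq 1$, be such that (i) $\lim_{k\to\infty} m_k=+\infty$, (ii) $\limsup_{k\to\infty}\,(1-|\lambda_k|)M_k<+\infty$. Assume that the map $\lambda_k\longmapsto M_k$, $k\geq 1$, has no harmonic majorant, i.e., there is no $H\in\mathrm{Har}_+(\mathbb{D})$ such that $M_k\leq H(\lambda_k)$ for all $k\geq 1$. Then there exist a subsequence of positive integers $\{k_i\}_{i\ge 1}$ and $H\in\mathrm{Har}_+(\mathbb{D})$ such that (a) $\dfrac{M_{k_i}}{m_{k_i}}\leq H(\lambda_{k_i})\leq M_{k_i}$ for all $i\geq 1$, (b) the map $\lambda_{k_i}\longmapsto M_{k_i}$, $i\geq 1$, has no harmonic majorant. Consequently, the map $\lambda_{k_i}\longmapsto m_{k_i}H(\lambda_{k_i})$, $i\geq 1$, has no harmonic majorant either.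
   Context: $\mathrm{Har}_+(\mathbb{D})$ is the cone of positive harmonic functions in the unit disk $\mathbb{D}$. A map $\lambda_{k}\mapsto a_k$, defined for $k$ in some index set, has a harmonic majorant if there is $U\in\mathrm{Har}_+(\mathbb{D})$ with $a_k\leq U(\lambda_k)$ for all $k$ in that index set. *)

theory Defs
  imports "HOL-Analysis.Analysis"
begin

(* Twice continuously Frechet differentiable with vanishing Laplacian: ux, uy are the first and
   uxx, uxy, uyx, uyy the second real partial derivatives on S, where uxy is the y-derivative
   of ux. *)
definition harmonic_on :: "(complex \<Rightarrow> real) \<Rightarrow> complex set \<Rightarrow> bool"
    (infixl "harmonic'_on" 50) where
  "u harmonic_on S \<longleftrightarrow> open S \<and>
     (\<exists>ux uy uxx uxy uyx uyy.
        (\<forall>z\<in>S. (u has_derivative (\<lambda>h. ux z * Re h + uy z * Im h)) (at z) \<and>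
               (ux has_derivative (\<lambda>h. uxx z * Re h + uxy z * Im h)) (at z) \<and>
               (uy has_derivative (\<lambda>h. uyx z * Re h + uyy z * Im h)) (at z) \<and>
               uxx z + uyy z = 0) \<and>
        continuous_on S uxx \<and> continuous_on S uxy \<and>
        continuous_on S uyx \<and> continuous_on S uyy)"

(* The functions are total on the complex plane; their values off the unit disk are irrelevant. *)
definition Har_pos :: "(complex \<Rightarrow> real) set" where
  "Har_pos = {u. u harmonic_on ball 0 1 \<and> (\<forall>z\<in>ball 0 1. 0 < u z)}"

definition has_harmonic_majorant :: "'i set \<Rightarrow> ('i \<Rightarrow> complex) \<Rightarrow> ('i \<Rightarrow> real) \<Rightarrow> bool" where
  "has_harmonic_majorant I lam a \<longleftrightarrow> (\<exists>U\<in>Har_pos. \<forall>k\<in>I. a k \<le> U (lam k))"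

end

theory Submission
  imports Defs "HOL-Complex_Analysis.Complex_Analysis"
begin

text \<open>
  For a set of indices, consider the least possible value at the origin of a positive harmonic
  majorant of \<open>M\<close> on that set. By normality of the positive harmonic functions that are bounded at
  the origin, \<open>M\<close> has no majorant on a set exactly when this value is unbounded over its finite subsets
  (\<open>majorant_from_finite_subsets\<close>). The subsequence is assembled from finite blocks whose values at
  the origin tend to infinity, which gives (b), and \<open>H\<close> is a sum of small multiples of majorants
  of the blocks, which gives the lower bound in (a) if the multiples are not smaller than \<open>1 / m\<close>.

  The main difficulty is the upper bound in (a), since a majorant of a block may be much larger than
  \<open>M\<close> at some of its points. Such points can be removed: if a block is minimal
  among the finite sets for which the value at the origin is at least \<open>a\<close>, then a nearly optimal
  majorant of it satisfies \<open>M \<le> U \<le> 2 * M\<close> on the block (\<open>near_minimal_majorant_is_tight\<close>).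
  Moreover \<open>U 0 < a + C\<close>: removing one point brings the value below \<open>a\<close>, and a Poisson kernel
  restores the point for at most \<open>C\<close>, a bound for \<open>(1 - norm (lam k)) * M k\<close>
  (\<open>majorant_below_insert\<close>).

  Blocks are added one at a time (\<open>admissible_extend\<close>). Contributions of later blocks to the
  earlier points are made small by Harnack's inequality, since the bound \<open>a + C\<close> at the origin is
  known before the block is; the factor \<open>e\<close> is chosen first, and the block is then taken far out,
  where \<open>m\<close> is at least \<open>1 / e\<close>. Contributions of earlier blocks to the later points are at most
  half of \<open>M\<close> because the points where \<open>M \<le> 2 * H\<close>, for the function \<open>H\<close> built so far, can be discarded: they
  have the majorant \<open>2 * H\<close>. The increasing sequence of functions stays bounded by 1 at the origin and
  therefore has a harmonic limit, which inherits (a).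

  The analytic facts rest on writing a positive harmonic function on the disk as the real part of a
  holomorphic function: Harnack's inequality is then the Schwarz lemma for a Moebius
  transform, and normality is Montel's theorem.
\<close>

section \<open>Harmonic functions as real parts of holomorphic functions\<close>

text \<open>
  The mean value theorem, used once in each variable, turns the second difference of \<open>f\<close> over the
  corners of a square into a value of a mixed derivative. As the second difference does not change
  when the two variables are interchanged, this is what makes the two mixed derivatives agree.
\<close>
lemma mixed_second_difference:
  fixes f :: "real \<Rightarrow> real \<Rightarrow> real"
  assumes "h > 0"
    and fx: "\<And>x y. \<lbrakk>x \<in> {a..a+h}; y \<in> {b..b+h}\<rbrakk> \<Longrightarrow> ((\<lambda>x. f x y) has_real_derivative fx x y) (at x)"
    and fxy: "\<And>x y. \<lbrakk>x \<in> {a..a+h}; y \<in> {b..b+h}\<rbrakk> \<Longrightarrow> ((\<lambda>y. fx x y) has_real_derivative fxy x y) (at y)"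
  shows "\<exists>x\<in>{a..a+h}. \<exists>y\<in>{b..b+h}.
           f (a+h) (b+h) - f (a+h) b - f a (b+h) + f a b = h * h * fxy x y"
proof -
  have "\<exists>x>a. x < a+h \<and> (f (a+h) (b+h) - f (a+h) b) - (f a (b+h) - f a b)
          = (a+h-a) * (fx x (b+h) - fx x b)"
    using \<open>h > 0\<close> by (intro MVT2) (auto intro!: derivative_intros fx)
  then obtain x where x: "a < x" "x < a+h"
    "f (a+h) (b+h) - f (a+h) b - f a (b+h) + f a b = h * (fx x (b+h) - fx x b)"
    by (auto simp: algebra_simps)
  have "\<exists>y>b. y < b+h \<and> fx x (b+h) - fx x b = (b+h-b) * fxy x y"
    using \<open>h > 0\<close> x by (intro MVT2) (auto intro!: fxy)
  then obtain y where "b < y" "y < b+h" "fx x (b+h) - fx x b = h * fxy x y"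
    by auto
  with x show ?thesis
    by (intro bexI[of _ x] bexI[of _ y]) auto
qed

lemma partial_derivatives_Complex:
  assumes "(u has_derivative (\<lambda>h. p * Re h + q * Im h)) (at (Complex x y))"
  shows "((\<lambda>x. u (Complex x y)) has_real_derivative p) (at x)"
    and "((\<lambda>y. u (Complex x y)) has_real_derivative q) (at y)"
proof -
  have 1: "((\<lambda>x. Complex x y) has_derivative (\<lambda>h. of_real h)) (at x)"
    unfolding Complex_eq by (auto intro!: derivative_eq_intros)
  show "((\<lambda>x. u (Complex x y)) has_real_derivative p) (at x)"
    using has_derivative_compose[OF 1 assms] by (simp add: has_field_derivative_def)
  have 2: "((\<lambda>y. Complex x y) has_derivative (\<lambda>h. \<i> * of_real h)) (at y)"
    unfolding Complex_eq by (auto intro!: derivative_eq_intros)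
  show "((\<lambda>y. u (Complex x y)) has_real_derivative q) (at y)"
    using has_derivative_compose[OF 2 assms] by (simp add: has_field_derivative_def)
qed

text \<open>
  The mixed partial derivatives in the definition of harmonicity are named separately, so their
  equality has to be derived. It is one half of the Cauchy--Riemann equations for
  \<open>ux - \<i> uy\<close>.
\<close>
lemma mixed_partials_eq:
  assumes "open S" "z \<in> S"
    and u: "\<And>z. z \<in> S \<Longrightarrow> (u has_derivative (\<lambda>h. ux z * Re h + uy z * Im h)) (at z)"
    and ux: "\<And>z. z \<in> S \<Longrightarrow> (ux has_derivative (\<lambda>h. uxx z * Re h + uxy z * Im h)) (at z)"
    and uy: "\<And>z. z \<in> S \<Longrightarrow> (uy has_derivative (\<lambda>h. uyx z * Re h + uyy z * Im h)) (at z)"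
    and cont: "continuous_on S uxy" "continuous_on S uyx"
  shows "uxy z = uyx z"
proof (rule ccontr)
  define a b where "a = Re z" and "b = Im z"
  assume "uxy z \<noteq> uyx z"
  define e where "e = \<bar>uxy z - uyx z\<bar> / 2"
  have "e > 0"
    using \<open>uxy z \<noteq> uyx z\<close> by (simp add: e_def)
  have "isCont uxy z" "isCont uyx z"
    using assms by (auto simp: continuous_on_eq_continuous_at)
  then have "\<forall>\<^sub>F w in at z. dist (uxy w) (uxy z) < e" "\<forall>\<^sub>F w in at z. dist (uyx w) (uyx z) < e"
    using \<open>e > 0\<close> by (auto simp: isCont_def tendsto_iff)
  then have "\<forall>\<^sub>F w in nhds z. dist (uxy w) (uxy z) < e \<and> dist (uyx w) (uyx z) < e \<and> w \<in> S"
    using \<open>e > 0\<close> assms(1,2) 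
    by (intro eventually_conj eventually_nhds_in_open) (auto simp: eventually_nhds_conv_at)
  then obtain d where "d > 0" and d: "\<And>w. dist w z < d \<Longrightarrow>
      dist (uxy w) (uxy z) < e \<and> dist (uyx w) (uyx z) < e \<and> w \<in> S"
    by (auto simp: eventually_nhds_metric)
  define h where "h = d / 3"
  have "h > 0" using \<open>d > 0\<close> by (simp add: h_def)
  have near: "dist (Complex x y) z < d" if "x \<in> {a..a+h}" "y \<in> {b..b+h}" for x y
  proof -
    have "norm (Complex x y - z) \<le> \<bar>x - a\<bar> + \<bar>y - b\<bar>"
      using cmod_le[of "Complex x y - z"] by (simp add: a_def b_def)
    also have "\<dots> < d" using that \<open>h > 0\<close> by (auto simp: h_def)
    finally show ?thesis by (simp add: dist_norm)
  qed
  have inS: "Complex x y \<in> S" if "x \<in> {a..a+h}" "y \<in> {b..b+h}" for x y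
    using d near[OF that] by blast
  obtain x1 y1 where 1: "x1 \<in> {a..a+h}" "y1 \<in> {b..b+h}"
     "u (Complex (a+h) (b+h)) - u (Complex (a+h) b) - u (Complex a (b+h)) + u (Complex a b)
        = h * h * uxy (Complex x1 y1)"
    using mixed_second_difference[OF \<open>h > 0\<close>, of a b "\<lambda>x y. u (Complex x y)" "\<lambda>x y. ux (Complex x y)"
        "\<lambda>x y. uxy (Complex x y)"] partial_derivatives_Complex(1)[OF u] partial_derivatives_Complex(2)[OF ux]
      inS by blast
  obtain x2 y2 where 2: "x2 \<in> {a..a+h}" "y2 \<in> {b..b+h}"
     "u (Complex (a+h) (b+h)) - u (Complex a (b+h)) - u (Complex (a+h) b) + u (Complex a b)
        = h * h * uyx (Complex x2 y2)"
    using mixed_second_difference[OF \<open>h > 0\<close>, of b a "\<lambda>y x. u (Complex x y)" "\<lambda>y x. uy (Complex x y)"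
        "\<lambda>y x. uyx (Complex x y)"] partial_derivatives_Complex(2)[OF u] partial_derivatives_Complex(1)[OF uy]
      inS by blast
  have "h * h * uxy (Complex x1 y1) = h * h * uyx (Complex x2 y2)"
    using 1(3) 2(3) by linarith
  then have "uxy (Complex x1 y1) = uyx (Complex x2 y2)"
    using \<open>h > 0\<close> by simp
  moreover have "dist (uxy (Complex x1 y1)) (uxy z) < e" "dist (uyx (Complex x2 y2)) (uyx z) < e"
    using d near 1 2 by blast+
  ultimately have "\<bar>uxy z - uyx z\<bar> < e + e"
    unfolding dist_real_def by argo
  then show False by (simp add: e_def)
qed

lemma Re_holomorphic_harmonic:
  assumes "open S" "f holomorphic_on S" and u: "\<And>z. z \<in> S \<Longrightarrow> u z = Re (f z)"
  shows "u harmonic_on S"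
proof -
  have 1: "deriv f holomorphic_on S" "deriv (deriv f) holomorphic_on S"
    using assms by (auto intro: holomorphic_deriv)
  have D: "(g has_derivative (\<lambda>h. deriv g z * h)) (at z)" if "g holomorphic_on S" "z \<in> S" for g z
    using that \<open>open S\<close> holomorphic_derivI[of g S z UNIV] by (simp add: has_field_derivative_def)
  have D2: "(u has_derivative (\<lambda>h. Re (deriv f z) * Re h + (- Im (deriv f z)) * Im h)) (at z)
     \<and> ((\<lambda>z. Re (deriv f z)) has_derivative
          (\<lambda>h. Re (deriv (deriv f) z) * Re h + (- Im (deriv (deriv f) z)) * Im h)) (at z)
     \<and> ((\<lambda>z. - Im (deriv f z)) has_derivative
          (\<lambda>h. (- Im (deriv (deriv f) z)) * Re h + (- Re (deriv (deriv f) z)) * Im h)) (at z)"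
    if "z \<in> S" for z
  proof (intro conjI)
    have "((\<lambda>z. Re (f z)) has_derivative (\<lambda>h. Re (deriv f z) * Re h + (- Im (deriv f z)) * Im h)) (at z)"
      using has_derivative_Re[OF D[OF assms(2) that]] by simp
    then show "(u has_derivative (\<lambda>h. Re (deriv f z) * Re h + (- Im (deriv f z)) * Im h)) (at z)"
      by (rule has_derivative_transform_within_open[OF _ \<open>open S\<close> that]) (simp add: u)
  next
    show "((\<lambda>z. Re (deriv f z)) has_derivative
          (\<lambda>h. Re (deriv (deriv f) z) * Re h + (- Im (deriv (deriv f) z)) * Im h)) (at z)"
      using has_derivative_Re[OF D[OF 1(1) that]] by simp
    show "((\<lambda>z. - Im (deriv f z)) has_derivative
          (\<lambda>h. (- Im (deriv (deriv f) z)) * Re h + (- Re (deriv (deriv f) z)) * Im h)) (at z)"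
      using has_derivative_minus[OF has_derivative_Im[OF D[OF 1(1) that]]] by (simp add: algebra_simps)
  qed
  have C2: "continuous_on S (\<lambda>z. Re (deriv (deriv f) z))" "continuous_on S (\<lambda>z. - Im (deriv (deriv f) z))"
      "continuous_on S (\<lambda>z. - Re (deriv (deriv f) z))"
    using holomorphic_on_imp_continuous_on[OF 1(2)] by (auto intro!: continuous_intros)
  show ?thesis
    unfolding harmonic_on_def
    by (rule conjI[OF \<open>open S\<close>], rule exI[of _ "\<lambda>z. Re (deriv f z)"],
        rule exI[of _ "\<lambda>z. - Im (deriv f z)"], rule exI[of _ "\<lambda>z. Re (deriv (deriv f) z)"],
        rule exI[of _ "\<lambda>z. - Im (deriv (deriv f) z)"], rule exI[of _ "\<lambda>z. - Im (deriv (deriv f) z)"],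
        rule exI[of _ "\<lambda>z. - Re (deriv (deriv f) z)"])
       (use D2 C2 in \<open>simp only: add.right_inverse simp_thms ball_simps, blast\<close>)
qed

text \<open>
  The function \<open>g = ux - \<i> uy\<close> satisfies the Cauchy--Riemann equations because of the vanishing
  Laplacian and the equality of the mixed derivatives. On a convex set it has a primitive, whose
  real part has the same differential as \<open>u\<close>; a constant of integration makes the values at \<open>z0\<close>
  agree.
\<close>
lemma harmonic_is_Re_holomorphic:
  assumes "u harmonic_on S" "convex S" "z0 \<in> S"
  shows "\<exists>f. f holomorphic_on S \<and> f z0 = of_real (u z0) \<and> (\<forall>z\<in>S. Re (f z) = u z)"
proof -
  from assms(1) obtain ux uy uxx uxy uyx uyy where S: "open S"
    and u: "\<And>z. z \<in> S \<Longrightarrow> (u has_derivative (\<lambda>h. ux z * Re h + uy z * Im h)) (at z)"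
    and ux: "\<And>z. z \<in> S \<Longrightarrow> (ux has_derivative (\<lambda>h. uxx z * Re h + uxy z * Im h)) (at z)"
    and uy: "\<And>z. z \<in> S \<Longrightarrow> (uy has_derivative (\<lambda>h. uyx z * Re h + uyy z * Im h)) (at z)"
    and lap: "\<And>z. z \<in> S \<Longrightarrow> uxx z + uyy z = 0"
    and cont: "continuous_on S uxy" "continuous_on S uyx"
    unfolding harmonic_on_def by blast
  define g where "g = (\<lambda>z. Complex (ux z) (- uy z))"
  have "(g has_field_derivative Complex (uxx z) (- uyx z)) (at z)" if "z \<in> S" for z
  proof -
    have eq: "uxy z = uyx z"
      using mixed_partials_eq[OF S that u ux uy cont] by blast
    have "uyy z = - uxx z" using lap[OF that] by simp
    have "((\<lambda>z. of_real (ux z) + \<i> * of_real (- uy z)) has_derivative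
        (\<lambda>h. of_real (uxx z * Re h + uxy z * Im h) + \<i> * of_real (- (uyx z * Re h + uyy z * Im h)))) (at z)"
      using that
      by (intro has_derivative_add has_derivative_mult_right has_derivative_of_real has_derivative_minus ux uy)
    then have "(g has_derivative (\<lambda>h. of_real (uxx z * Re h + uxy z * Im h)
                 + \<i> * of_real (- (uyx z * Re h + uyy z * Im h)))) (at z)"
      by (simp only: g_def Complex_eq)
    also have "(\<lambda>h. of_real (uxx z * Re h + uxy z * Im h) + \<i> * of_real (- (uyx z * Re h + uyy z * Im h)))
        = (*) (Complex (uxx z) (- uyx z))"
      by (rule ext) (auto simp: complex_eq_iff eq \<open>uyy z = - uxx z\<close> algebra_simps)
    finally show ?thesis by (simp add: has_field_derivative_def)
  qed
  then have "g holomorphic_on S"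
    using S by (meson DERIV_subset field_differentiable_def holomorphic_on_def subset_UNIV)
  then obtain F where "\<And>z. z \<in> S \<Longrightarrow> (F has_field_derivative g z) (at z within S)"
    using holomorphic_convex_primitive'[OF \<open>convex S\<close> S] by blast
  then have F: "(F has_field_derivative g z) (at z)" if "z \<in> S" for z
    using that S by (metis at_within_open)
  have "((\<lambda>z. Re (F z) - u z) has_derivative (\<lambda>h. 0)) (at z within S)" if "z \<in> S" for z
  proof -
    have "(F has_derivative (\<lambda>h. g z * h)) (at z)"
      using F[OF that] by (simp add: has_field_derivative_def)
    then have "((\<lambda>z. Re (F z) - u z) has_derivative
                 (\<lambda>h. Re (g z * h) - (ux z * Re h + uy z * Im h))) (at z)"
      by (intro has_derivative_diff has_derivative_Re u that)
    moreover have "(\<lambda>h. Re (g z * h) - (ux z * Re h + uy z * Im h)) = (\<lambda>h. 0)"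
      by (auto simp: g_def)
    ultimately show ?thesis
      by (metis has_derivative_at_withinI)
  qed
  then obtain c where c: "\<And>z. z \<in> S \<Longrightarrow> Re (F z) - u z = c"
    using has_derivative_zero_constant[OF \<open>convex S\<close>, of "\<lambda>z. Re (F z) - u z"] by auto
  define f where "f = (\<lambda>z. F z - Complex c (Im (F z0)))"
  have "f holomorphic_on S"
    unfolding f_def using F S
    by (intro holomorphic_intros) (auto simp: holomorphic_on_open)
  moreover have "f z0 = of_real (u z0)" "\<forall>z\<in>S. Re (f z) = u z"
    using c assms(3) by (auto simp: f_def complex_eq_iff algebra_simps)
  ultimately show ?thesis by blast
qed

text \<open>
  This description gives access to the Schwarz lemma and to Montel's theorem. The normalisation
  at the origin is the one under which the Schwarz lemma becomes Harnack's inequality.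
\<close>
lemma Har_pos_iff_Re_holomorphic:
  "u \<in> Har_pos \<longleftrightarrow> (\<exists>f. f holomorphic_on ball 0 1 \<and> f 0 = of_real (u 0) \<and>
                       (\<forall>z\<in>ball 0 1. Re (f z) = u z \<and> 0 < u z))"
proof
  assume "u \<in> Har_pos"
  then show "\<exists>f. f holomorphic_on ball 0 1 \<and> f 0 = of_real (u 0) \<and>
                       (\<forall>z\<in>ball 0 1. Re (f z) = u z \<and> 0 < u z)"
    using harmonic_is_Re_holomorphic[of u "ball 0 1" 0] by (auto simp: Har_pos_def)
next
  assume "\<exists>f. f holomorphic_on ball 0 1 \<and> f 0 = of_real (u 0) \<and>
                       (\<forall>z\<in>ball 0 1. Re (f z) = u z \<and> 0 < u z)"
  then obtain f where "f holomorphic_on ball 0 1" "\<And>z. z \<in> ball 0 1 \<Longrightarrow> Re (f z) = u z"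
    "\<And>z. z \<in> ball 0 1 \<Longrightarrow> 0 < u z"
    by blast
  then show "u \<in> Har_pos"
    using Re_holomorphic_harmonic[OF open_ball, of f 0 1 u] by (simp add: Har_pos_def)
qed

lemma Har_posD:
  assumes "u \<in> Har_pos"
  obtains f where "f holomorphic_on ball 0 1" "f 0 = of_real (u 0)"
    "\<And>z. norm z < 1 \<Longrightarrow> Re (f z) = u z" "\<And>z. norm z < 1 \<Longrightarrow> 0 < u z"
proof -
  from iffD1[OF Har_pos_iff_Re_holomorphic assms]
  obtain f where "f holomorphic_on ball 0 1 \<and> f 0 = of_real (u 0) \<and>
                       (\<forall>z\<in>ball 0 1. Re (f z) = u z \<and> 0 < u z)" ..
  then show thesis by (intro that[of f]) auto
qed

lemma Har_posI:
  assumes "f holomorphic_on ball 0 1" "\<And>z. norm z < 1 \<Longrightarrow> u z = Re (f z)"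
    "\<And>z. norm z < 1 \<Longrightarrow> 0 < u z"
  shows "u \<in> Har_pos"
  using assms Re_holomorphic_harmonic[OF open_ball, of f 0 1 u] by (auto simp: Har_pos_def)

lemma Har_pos_gt_0: "u \<in> Har_pos \<Longrightarrow> norm z < 1 \<Longrightarrow> 0 < u z"
  by (simp add: Har_pos_def)

lemma Har_pos_const: "c > 0 \<Longrightarrow> (\<lambda>_. c) \<in> Har_pos"
  by (rule Har_posI[of "\<lambda>_. of_real c"]) auto

lemma Har_pos_add:
  assumes "u \<in> Har_pos" "v \<in> Har_pos"
  shows "(\<lambda>z. u z + v z) \<in> Har_pos"
proof -
  obtain f where f: "f holomorphic_on ball 0 1" "\<And>z. norm z < 1 \<Longrightarrow> Re (f z) = u z" "\<And>z. norm z < 1 \<Longrightarrow> 0 < u z"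
    using Har_posD[OF assms(1)] by metis
  obtain g where g: "g holomorphic_on ball 0 1" "\<And>z. norm z < 1 \<Longrightarrow> Re (g z) = v z" "\<And>z. norm z < 1 \<Longrightarrow> 0 < v z"
    using Har_posD[OF assms(2)] by metis
  show ?thesis
    using f g by (intro Har_posI[of "\<lambda>z. f z + g z"] holomorphic_intros) (auto intro: add_pos_pos)
qed

lemma Har_pos_scale:
  assumes "u \<in> Har_pos" "c > 0"
  shows "(\<lambda>z. c * u z) \<in> Har_pos"
proof -
  obtain f where f: "f holomorphic_on ball 0 1" "\<And>z. norm z < 1 \<Longrightarrow> Re (f z) = u z" "\<And>z. norm z < 1 \<Longrightarrow> 0 < u z"
    using Har_posD[OF assms(1)] by metis
  show ?thesis
    using f \<open>c > 0\<close> by (intro Har_posI[of "\<lambda>z. of_real c * f z"] holomorphic_intros) auto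
qed

lemma Re_Cayley_pos:
  assumes "norm w < 1"
  shows "0 < Re ((1 + w) / (1 - w))"
proof -
  have ne: "1 - w \<noteq> 0" using assms by auto
  have "(Re w)\<^sup>2 + (Im w)\<^sup>2 < 1"
    using assms abs_square_less_1[of "norm w"] by (simp flip: cmod_power2)
  moreover have "0 < (1 - Re w)\<^sup>2 + (Im w)\<^sup>2"
    using ne by (auto simp: complex_eq_iff sum_power2_gt_zero_iff)
  ultimately show ?thesis
    by (simp add: Re_divide algebra_simps power2_eq_square)
qed

section \<open>Harnack's inequality, normality and the Poisson kernel\<close>

text \<open>
  The Moebius map \<open>w \<mapsto> (w - a) / (w + a)\<close> takes the right half plane to the disk and \<open>a\<close> to 0, so
  the Schwarz lemma bounds the composition \<open>g\<close> by \<open>norm z\<close>. Solving for \<open>f\<close> gives the estimate.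
\<close>
lemma Harnack_holomorphic:
  assumes f: "f holomorphic_on ball 0 1" "f 0 = of_real a" "\<And>z. norm z < 1 \<Longrightarrow> 0 < Re (f z)"
    and z: "norm z < 1"
  shows "norm (f z) \<le> a * (1 + norm z) / (1 - norm z)"
proof -
  have "a > 0" using f(2) f(3)[of 0] by simp
  define g where "g = (\<lambda>z. (f z - of_real a) / (f z + of_real a))"
  have ne: "f w + of_real a \<noteq> 0" if "norm w < 1" for w
    using f(3)[OF that] \<open>a > 0\<close> by (auto simp: complex_eq_iff)
  have "norm (g w) < 1" if "norm w < 1" for w
  proof -
    have "(norm (f w - of_real a))\<^sup>2 < (norm (f w + of_real a))\<^sup>2"
      unfolding cmod_power2 using f(3)[OF that] \<open>a > 0\<close> by (simp add: power2_eq_square algebra_simps)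
    then have "norm (f w - of_real a) < norm (f w + of_real a)"
      using power2_less_imp_less norm_ge_zero by blast
    then show ?thesis
      using ne[OF that] by (simp add: g_def norm_divide)
  qed
  moreover have "g holomorphic_on ball 0 1"
    unfolding g_def using f(1) ne by (intro holomorphic_intros) auto
  ultimately have gz: "norm (g z) \<le> norm z"
    using Schwarz_Lemma(1)[of g z] z f(2) by (simp add: g_def)
  have "f z * (1 - g z) = of_real a * (1 + g z)"
    using ne[OF z] by (simp add: g_def field_simps)
  then have "norm (f z) * norm (1 - g z) = a * norm (1 + g z)"
    using \<open>a > 0\<close> by (metis norm_mult norm_of_real abs_of_pos)
  moreover have "1 - norm z \<le> norm (1 - g z)"
    using gz norm_triangle_ineq2[of 1 "g z"] by simp
  moreover have "norm (1 + g z) \<le> 1 + norm z"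
    using gz norm_triangle_ineq[of 1 "g z"] by simp
  ultimately have "norm (f z) * (1 - norm z) \<le> a * (1 + norm z)"
    using \<open>a > 0\<close> by (metis mult_left_mono norm_ge_zero order_trans less_imp_le)
  then show ?thesis using z by (simp add: field_simps)
qed

lemma Harnack_upper:
  assumes "u \<in> Har_pos" "norm z < 1"
  shows "u z \<le> u 0 * (1 + norm z) / (1 - norm z)"
proof -
  obtain f where f: "f holomorphic_on ball 0 1" "f 0 = of_real (u 0)"
    "\<And>z. norm z < 1 \<Longrightarrow> Re (f z) = u z" "\<And>z. norm z < 1 \<Longrightarrow> 0 < u z"
    using Har_posD[OF assms(1)] by metis
  have "u z \<le> norm (f z)"
    using complex_Re_le_cmod[of "f z"] f(3)[OF assms(2)] by simp
  also have "\<dots> \<le> u 0 * (1 + norm z) / (1 - norm z)"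
    using f assms(2) by (intro Harnack_holomorphic) auto
  finally show ?thesis .
qed

text \<open>
  Harnack's inequality turns a bound at the origin into a locally uniform bound for the
  holomorphic functions, to which Montel's theorem applies. The limit may vanish, so it need not
  belong to the cone.
\<close>
lemma Har_pos_normal_family:
  fixes u :: "nat \<Rightarrow> complex \<Rightarrow> real"
  assumes u: "\<And>n. u n \<in> Har_pos" and A: "\<And>n. u n 0 \<le> A"
  obtains g r where "g holomorphic_on ball 0 1" "strict_mono (r :: nat \<Rightarrow> nat)"
    "\<And>z. norm z < 1 \<Longrightarrow> (\<lambda>n. u (r n) z) \<longlonglongrightarrow> Re (g z)"
proof -
  have "\<forall>n. \<exists>f. f holomorphic_on ball 0 1 \<and> f 0 = of_real (u n 0) \<and>
                       (\<forall>z\<in>ball 0 1. Re (f z) = u n z \<and> 0 < u n z)"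
    using u unfolding Har_pos_iff_Re_holomorphic by blast
  then obtain f where f: "\<And>n. f n holomorphic_on ball 0 1" "\<And>n. f n 0 = of_real (u n 0)"
     "\<And>n z. norm z < 1 \<Longrightarrow> Re (f n z) = u n z"
     "\<And>n z. norm z < 1 \<Longrightarrow> 0 < Re (f n z)"
    by (metis dist_0_norm mem_ball)
  have bdd: "\<exists>B. \<forall>h\<in>range f. \<forall>z\<in>K. norm (h z) \<le> B" if K: "compact K" "K \<subseteq> ball 0 1" for K
  proof -
    have "continuous_on K (\<lambda>z. A * (1 + norm z) / (1 - norm z))"
      using K(2) by (intro continuous_intros) auto
    then have "bounded ((\<lambda>z. A * (1 + norm z) / (1 - norm z)) ` K)"
      using K(1) compact_continuous_image compact_imp_bounded by blast
    then obtain B where "\<forall>z\<in>K. \<bar>A * (1 + norm z) / (1 - norm z)\<bar> \<le> B"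
      unfolding bounded_real ball_simps by blast
    then have B: "A * (1 + norm z) / (1 - norm z) \<le> B" if "z \<in> K" for z
      using abs_le_D1 that by blast
    have "norm (f n z) \<le> B" if "z \<in> K" for n z
    proof -
      have "norm z < 1" using that K(2) by auto
      have "norm (f n z) \<le> u n 0 * (1 + norm z) / (1 - norm z)"
        using Harnack_holomorphic[OF f(1,2,4) \<open>norm z < 1\<close>] .
      also have "\<dots> \<le> A * (1 + norm z) / (1 - norm z)"
        using \<open>norm z < 1\<close> A[of n] by (intro divide_right_mono mult_right_mono) auto
      also have "\<dots> \<le> B" using B[OF that] .
      finally show ?thesis .
    qed
    then show ?thesis by (intro exI[of _ B]) auto
  qed
  obtain g r where g: "g holomorphic_on ball 0 1" "strict_mono (r :: nat \<Rightarrow> nat)"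
    "\<And>z. z \<in> ball 0 1 \<Longrightarrow> (\<lambda>n. f (r n) z) \<longlonglongrightarrow> g z"
  proof (rule Montel[of "ball 0 1" "range f" f])
    show "h holomorphic_on ball 0 1" if "h \<in> range f" for h
      using that f(1) by auto
  qed (use bdd in auto)
  have "(\<lambda>n. u (r n) z) \<longlonglongrightarrow> Re (g z)" if "norm z < 1" for z
    using tendsto_Re[OF g(3)[of z]] that f(3) by simp
  with g(1,2) show thesis by (rule that)
qed

text \<open>
  The Poisson kernel with pole at \<open>w / norm w\<close> is as large at \<open>w\<close> as Harnack's inequality permits. Scaled by \<open>(1 - norm w) * b\<close>, it reaches the value \<open>b\<close> at \<open>w\<close> at the cost of
  only \<open>(1 - norm w) * b\<close> at the origin.
\<close>
lemma Poisson_peak: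
  assumes w: "norm w < 1"
  obtains P where "P \<in> Har_pos" "P 0 = 1" "1 / (1 - norm w) \<le> P w"
proof -
  (* s is the conjugate of the boundary point next to w; at w = 0 every boundary point will do. *)
  define s where "s = (if w = 0 then 1 else cnj (sgn w))"
  have s: "norm s = 1" "s * w = of_real (norm w)"
    using complex_norm_square[of w]
    by (auto simp: s_def norm_divide sgn_eq power2_eq_square field_simps)
  define P where "P = (\<lambda>z. Re ((1 + s * z) / (1 - s * z)))"
  have lt: "norm (s * z) < 1" if "norm z < 1" for z
    using that s by (simp add: norm_mult)
  have ne: "s * z \<noteq> 1" if "norm z < 1" for z
    using lt[OF that] by auto
  have "P \<in> Har_pos"
    using ne Re_Cayley_pos[OF lt]
    by (intro Har_posI[of "\<lambda>z. (1 + s * z) / (1 - s * z)"] holomorphic_intros) (auto simp: P_def)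
  moreover have "P 0 = 1" by (simp add: P_def)
  moreover have "(1 + s * w) / (1 - s * w) = of_real ((1 + norm w) / (1 - norm w))"
    by (simp add: s(2))
  then have "P w = (1 + norm w) / (1 - norm w)"
    unfolding P_def by (simp only: Re_complex_of_real)
  then have "1 / (1 - norm w) \<le> P w"
    using w by (simp add: divide_right_mono)
  ultimately show thesis using that by blast
qed

section \<open>Majorants with a prescribed bound at the origin\<close>

text \<open>
  The least value at the origin of a majorant measures how far \<open>M\<close> on \<open>I\<close> is from having no
  majorant. The predicate says that this infimum is less than \<open>a\<close>, which avoids a separate treatment
  of index sets without a majorant, where the infimum is over the empty set.
\<close>
definition majorant_below :: "'i set \<Rightarrow> ('i \<Rightarrow> complex) \<Rightarrow> ('i \<Rightarrow> real) \<Rightarrow> real \<Rightarrow> bool" where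
  "majorant_below I lam M a \<longleftrightarrow> (\<exists>U\<in>Har_pos. U 0 < a \<and> (\<forall>k\<in>I. M k \<le> U (lam k)))"

lemma has_harmonic_majorantI:
  assumes "U \<in> Har_pos" "\<And>k. k \<in> I \<Longrightarrow> M k \<le> U (lam k)"
  shows "has_harmonic_majorant I lam M"
  unfolding has_harmonic_majorant_def using assms by (intro bexI[of _ U]) auto

lemma has_harmonic_majorantE:
  assumes "has_harmonic_majorant I lam M"
  obtains U where "U \<in> Har_pos" "\<And>k. k \<in> I \<Longrightarrow> M k \<le> U (lam k)"
  using assms unfolding has_harmonic_majorant_def by (elim bexE) simp

lemma majorant_belowI:
  assumes "U \<in> Har_pos" "U 0 < a" "\<And>k. k \<in> I \<Longrightarrow> M k \<le> U (lam k)"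
  shows "majorant_below I lam M a"
  unfolding majorant_below_def using assms by (intro bexI[of _ U]) auto

lemma majorant_belowE:
  assumes "majorant_below I lam M a"
  obtains U where "U \<in> Har_pos" "U 0 < a" "\<And>k. k \<in> I \<Longrightarrow> M k \<le> U (lam k)"
  using assms unfolding majorant_below_def by (elim bexE) simp

lemma majorant_below_subset:
  "majorant_below J lam M a \<Longrightarrow> I \<subseteq> J \<Longrightarrow> majorant_below I lam M a"
  unfolding majorant_below_def by blast

lemma has_harmonic_majorant_finite:
  assumes "finite I"
  shows "has_harmonic_majorant I lam M"
proof -
  have "M k \<le> 1 + (\<Sum>i\<in>I. \<bar>M i\<bar>)" if "k \<in> I" for k
    using member_le_sum[OF that, of "\<lambda>i. \<bar>M i\<bar>"] assms by force
  then show ?thesis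
  proof (rule has_harmonic_majorantI[rotated])
    show "(\<lambda>_. 1 + (\<Sum>i\<in>I. \<bar>M i\<bar>)) \<in> Har_pos"
      by (rule Har_pos_const) (simp add: add_pos_nonneg sum_nonneg)
  qed
qed

lemma has_harmonic_majorant_Un:
  assumes lam: "\<And>k. norm (lam k) < 1"
    and "has_harmonic_majorant I lam M" "has_harmonic_majorant J lam M"
  shows "has_harmonic_majorant (I \<union> J) lam M"
proof -
  obtain U where U: "U \<in> Har_pos" "\<And>k. k \<in> I \<Longrightarrow> M k \<le> U (lam k)"
    using assms(2) by (rule has_harmonic_majorantE) (rule that)
  obtain V where V: "V \<in> Har_pos" "\<And>k. k \<in> J \<Longrightarrow> M k \<le> V (lam k)"
    using assms(3) by (rule has_harmonic_majorantE) (rule that)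
  have "M k \<le> U (lam k) + V (lam k)" if "k \<in> I \<union> J" for k
    using U(2)[of k] V(2)[of k] that Har_pos_gt_0[OF U(1) lam, of k] Har_pos_gt_0[OF V(1) lam, of k]
    by fastforce
  then show ?thesis
    by (rule has_harmonic_majorantI[OF Har_pos_add[OF U(1) V(1)]])
qed

text \<open>
  A compactness argument: if majorants of the finite sections stay bounded at the origin, then
  a subsequence of them converges, and its limit majorizes \<open>M\<close> on all of \<open>S\<close>. Hence a set without a
  majorant contains finite sets whose majorants are all large at the origin.
\<close>
lemma majorant_from_finite_subsets:
  fixes S :: "nat set"
  assumes lam: "\<And>k. norm (lam k) < 1"
    and fin: "\<And>F. finite F \<Longrightarrow> F \<subseteq> S \<Longrightarrow> majorant_below F lam M a"
  shows "has_harmonic_majorant S lam M"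
proof -
  have "\<exists>U. U \<in> Har_pos \<and> U 0 < a \<and> (\<forall>k\<in>S \<inter> {..n}. M k \<le> U (lam k))" for n
    using fin[of "S \<inter> {..n}"] unfolding majorant_below_def by auto
  then obtain U where U: "\<And>n. U n \<in> Har_pos" "\<And>n. U n 0 < a"
    "\<And>n k. k \<in> S \<Longrightarrow> k \<le> n \<Longrightarrow> M k \<le> U n (lam k)"
    by (metis IntI atMost_iff)
  obtain g r where g: "g holomorphic_on ball 0 1" and r: "strict_mono (r :: nat \<Rightarrow> nat)"
    and lim: "\<And>z. norm z < 1 \<Longrightarrow> (\<lambda>n. U (r n) z) \<longlonglongrightarrow> Re (g z)"
    by (rule Har_pos_normal_family[where u = U and A = a, OF U(1) less_imp_le[OF U(2)]]) (rule that)
  (* The limit is only known to be nonnegative; adding 1 makes it a member of the cone. *)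
  define v where "v = (\<lambda>z. Re (g z) + 1)"
  have "0 \<le> Re (g z)" if "norm z < 1" for z
    by (rule LIMSEQ_le_const[OF lim[OF that]]) (auto intro!: less_imp_le Har_pos_gt_0 U that)
  then have "v \<in> Har_pos"
    using g by (intro Har_posI[of "\<lambda>z. g z + 1"] holomorphic_intros)
      (auto simp: v_def add_nonneg_pos)
  moreover have "M k \<le> v (lam k)" if "k \<in> S" for k
  proof -
    have "M k \<le> U (r n) (lam k)" if "n \<ge> k" for n
      using U(3)[OF \<open>k \<in> S\<close>, of "r n"] seq_suble[OF r, of n] that by force
    then have "M k \<le> Re (g (lam k))"
      by (intro LIMSEQ_le_const[OF lim[OF lam]]) blast
    then show ?thesis by (simp add: v_def)
  qed
  ultimately show ?thesis by (rule has_harmonic_majorantI)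
qed

text \<open>
  One further point costs at most \<open>C\<close> at the origin, by adding a multiple of the Poisson kernel
  that peaks there. This is the use of the growth condition on \<open>M\<close>.
\<close>
lemma majorant_below_insert:
  assumes lam: "\<And>k. norm (lam k) < 1" and M: "\<And>k. 0 < M k"
    and growth: "(1 - norm (lam j)) * M j \<le> C"
    and F: "majorant_below (F - {j}) lam M a"
  shows "majorant_below F lam M (a + C)"
proof -
  obtain V where V: "V \<in> Har_pos" "V 0 < a" "\<And>k. k \<in> F - {j} \<Longrightarrow> M k \<le> V (lam k)"
    using F by (rule majorant_belowE) (rule that)
  obtain P where P: "P \<in> Har_pos" "P 0 = 1" "1 / (1 - norm (lam j)) \<le> P (lam j)"
    by (rule Poisson_peak[OF lam]) (rule that)
  define c where "c = (1 - norm (lam j)) * M j"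
  have "c > 0" using lam[of j] M[of j] by (simp add: c_def)
  have "M j = c * (1 / (1 - norm (lam j)))" using lam[of j] by (simp add: c_def)
  also have "\<dots> \<le> c * P (lam j)" using P(3) \<open>c > 0\<close> by (intro mult_left_mono) auto
  finally have j: "M j \<le> c * P (lam j)" .
  have "M k \<le> V (lam k) + c * P (lam k)" if "k \<in> F" for k
  proof (cases "k = j")
    case True
    then show ?thesis using j Har_pos_gt_0[OF V(1) lam, of k] by simp
  next
    case False
    then show ?thesis using V(3)[of k] that mult_pos_pos[OF \<open>c > 0\<close> Har_pos_gt_0[OF P(1) lam, of k]] by simp
  qed
  moreover have "(\<lambda>z. V z + c * P z) \<in> Har_pos"
    by (intro Har_pos_add Har_pos_scale V P \<open>c > 0\<close>)
  moreover have "V 0 + c * P 0 < a + C"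
    using V(2) P(2) growth by (simp add: c_def)
  ultimately show ?thesis
    by (intro majorant_belowI[of "\<lambda>z. V z + c * P z"])
qed

section \<open>Finite blocks on which a majorant is tight\<close>

text \<open>
  On a minimal finite set without a majorant below \<open>a\<close>, a majorant that is nearly optimal at the
  origin is comparable to \<open>M\<close>. Indeed, suppose that \<open>U\<close> exceeds \<open>2 * M\<close> at the point of index \<open>k\<close>.
  By minimality, some \<open>V\<close> with \<open>V 0 < a\<close> majorizes \<open>M\<close> at all the other points. The mean
  of \<open>U\<close> and \<open>V\<close> still majorizes \<open>M\<close> everywhere, at \<open>k\<close> because half of \<open>U\<close> suffices there. As \<open>V 0\<close>
  is smaller than the infimum \<open>c\<close> of the values at the origin, this mean falls below \<open>c\<close> if
  \<open>U 0\<close> was close enough to \<open>c\<close>.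
\<close>
lemma near_minimal_majorant_is_tight:
  fixes F :: "nat set"
  assumes lam: "\<And>k. norm (lam k) < 1" and M: "\<And>k. 0 < M k"
    and growth: "\<And>k. (1 - norm (lam k)) * M k \<le> C"
    and "finite F"
    and not_F: "\<not> majorant_below F lam M a"
    and minimal: "\<And>k. k \<in> F \<Longrightarrow> majorant_below (F - {k}) lam M a"
    and "F \<noteq> {}"
  obtains U where "U \<in> Har_pos" "U 0 < a + C"
    "\<And>k. k \<in> F \<Longrightarrow> M k \<le> U (lam k) \<and> U (lam k) \<le> 2 * M k"
proof -
  define X where "X = {U 0 | U. U \<in> Har_pos \<and> (\<forall>k\<in>F. M k \<le> U (lam k))}"
  define c where "c = Inf X"
  have bdd: "bdd_below X"
    by (rule bdd_belowI[of _ 0]) (auto simp: X_def intro!: less_imp_le Har_pos_gt_0)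
  obtain k0 where "k0 \<in> F" using \<open>F \<noteq> {}\<close> by blast
  have "majorant_below F lam M (a + C)"
    using majorant_below_insert[OF lam M growth minimal[OF \<open>k0 \<in> F\<close>]] .
  then obtain W where W: "W \<in> Har_pos" "W 0 < a + C" "\<And>k. k \<in> F \<Longrightarrow> M k \<le> W (lam k)"
    by (rule majorant_belowE) (rule that)
  have "W 0 \<in> X" using W by (auto simp: X_def)
  have "a \<le> x" if "x \<in> X" for x
    using that not_F unfolding X_def majorant_below_def by force
  then have "a \<le> c"
    unfolding c_def using \<open>W 0 \<in> X\<close> by (intro cInf_greatest) auto
  have "c < a + C"
    using cInf_lower[OF \<open>W 0 \<in> X\<close> bdd] W(2) by (simp add: c_def)
  have "\<forall>k\<in>F. \<exists>V. V \<in> Har_pos \<and> V 0 < a \<and> (\<forall>i\<in>F - {k}. M i \<le> V (lam i))"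
    using minimal unfolding majorant_below_def by blast
  then obtain V where V: "\<And>k. k \<in> F \<Longrightarrow> V k \<in> Har_pos" "\<And>k. k \<in> F \<Longrightarrow> V k 0 < a"
    "\<And>k i. k \<in> F \<Longrightarrow> i \<in> F - {k} \<Longrightarrow> M i \<le> V k (lam i)"
    by metis
  (* U 0 < 2 * c - V k 0 says that the mean of U and V k is less than c at the origin. The entry
     a + C keeps the value of U at the origin under control. *)
  define b where "b = Min (insert (a + C) ((\<lambda>k. 2 * c - V k 0) ` F))"
  have "c < b"
    unfolding b_def using \<open>finite F\<close> \<open>c < a + C\<close> V(2) \<open>a \<le> c\<close> by (subst Min_gr_iff) force+
  then obtain x where "x \<in> X" "x < b"
    using cInf_lessD[of X b] \<open>W 0 \<in> X\<close> by (auto simp: c_def)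
  then obtain U where U: "U \<in> Har_pos" "U 0 < b" "\<And>k. k \<in> F \<Longrightarrow> M k \<le> U (lam k)"
    by (auto simp: X_def)
  have "U (lam k) \<le> 2 * M k" if k: "k \<in> F" for k
  proof (rule ccontr)
    assume gt: "\<not> U (lam k) \<le> 2 * M k"
    define Y where "Y = (\<lambda>z. (1/2) * (U z + V k z))"
    have "Y \<in> Har_pos"
      unfolding Y_def by (intro Har_pos_scale Har_pos_add U V k) auto
    moreover have "M i \<le> Y (lam i)" if "i \<in> F" for i
      using U(3)[OF that] V(3)[OF k, of i] that gt Har_pos_gt_0[OF V(1)[OF k] lam, of k]
      by (cases "i = k") (auto simp: Y_def)
    ultimately have "Y 0 \<in> X" by (auto simp: X_def)
    then have "c \<le> Y 0" unfolding c_def using bdd by (rule cInf_lower)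
    moreover have "b \<le> 2 * c - V k 0"
      unfolding b_def using \<open>finite F\<close> k by (intro Min_le) auto
    ultimately show False using U(2) by (simp add: Y_def)
  qed
  moreover have "U 0 < a + C"
    using U(2) \<open>finite F\<close> by (simp add: b_def)
  ultimately show thesis using that U by blast
qed

lemma tight_block:
  fixes S :: "nat set"
  assumes lam: "\<And>k. norm (lam k) < 1" and M: "\<And>k. 0 < M k"
    and growth: "\<And>k. (1 - norm (lam k)) * M k \<le> C"
    and S: "\<not> has_harmonic_majorant S lam M" and "0 < a"
  obtains F U where "finite F" "F \<subseteq> S" "\<not> majorant_below F lam M a"
    "U \<in> Har_pos" "U 0 < a + C"
    "\<And>k. k \<in> F \<Longrightarrow> M k \<le> U (lam k) \<and> U (lam k) \<le> 2 * M k"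
proof -
  let ?P = "\<lambda>F. finite F \<and> F \<subseteq> S \<and> \<not> majorant_below F lam M a"
  have "\<exists>F. ?P F"
  proof (rule ccontr)
    assume "\<nexists>F. ?P F"
    then have "majorant_below F lam M a" if "finite F" "F \<subseteq> S" for F
      using that by metis
    then have "has_harmonic_majorant S lam M"
      by (rule majorant_from_finite_subsets[where lam = lam, OF lam])
    with S show False by contradiction
  qed
  then obtain F where F: "?P F" and least: "\<And>G. ?P G \<Longrightarrow> card F \<le> card G"
    using ex_has_least_nat[of ?P _ card] by metis
  have "majorant_below (F - {k}) lam M a" if "k \<in> F" for k
    using least[of "F - {k}"] F card_Diff1_less[of F k] that by fastforce
  moreover have "F \<noteq> {}"
  proof
    assume "F = {}"
    then have "majorant_below F lam M a"
      using \<open>0 < a\<close> by (intro majorant_belowI[of "\<lambda>_. a/2"] Har_pos_const) auto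
    with F show False by simp
  qed
  ultimately obtain U where "U \<in> Har_pos" "U 0 < a + C"
      "\<And>k. k \<in> F \<Longrightarrow> M k \<le> U (lam k) \<and> U (lam k) \<le> 2 * M k"
    using F near_minimal_majorant_is_tight[where lam = lam and F = F and a = a, OF lam M growth] by metis
  with F show thesis by (intro that) auto
qed

section \<open>Adding blocks one at a time\<close>

text \<open>
  The discarded points are harmless: finitely many of them have small \<open>m\<close>, and on the others
  \<open>2 * H\<close> is a majorant. On the points that remain, the function built so far leaves at least half of
  \<open>M\<close> for the next block.
\<close>
lemma not_has_harmonic_majorant_tail:
  fixes m M :: "nat \<Rightarrow> real"
  assumes lam: "\<And>k. norm (lam k) < 1"
    and m_lim: "filterlim m at_top sequentially"
    and no_maj: "\<not> has_harmonic_majorant UNIV lam M"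
    and H: "H \<in> Har_pos"
  shows "\<not> has_harmonic_majorant {k. b \<le> m k \<and> 2 * H (lam k) < M k} lam M"
proof
  assume *: "has_harmonic_majorant {k. b \<le> m k \<and> 2 * H (lam k) < M k} lam M"
  have "\<forall>\<^sub>F k in sequentially. b \<le> m k"
    using m_lim by (auto simp: filterlim_at_top)
  then obtain N where "\<And>k. k \<ge> N \<Longrightarrow> b \<le> m k"
    by (auto simp: eventually_sequentially)
  then have "{k. m k < b} \<subseteq> {..<N}"
    by (metis (no_types, lifting) lessThan_iff linorder_not_less mem_Collect_eq subsetI)
  then have fin: "has_harmonic_majorant {k. m k < b} lam M"
    by (intro has_harmonic_majorant_finite) (rule finite_subset, auto)
  have "has_harmonic_majorant {k. M k \<le> 2 * H (lam k)} lam M"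
    by (rule has_harmonic_majorantI[OF Har_pos_scale[OF H, of 2]]) auto
  from has_harmonic_majorant_Un[OF lam this has_harmonic_majorant_Un[OF lam fin *]]
  have "has_harmonic_majorant ({k. M k \<le> 2 * H (lam k)} \<union>
          ({k. m k < b} \<union> {k. b \<le> m k \<and> 2 * H (lam k) < M k})) lam M" .
  also have "{k. M k \<le> 2 * H (lam k)} \<union>
          ({k. m k < b} \<union> {k. b \<le> m k \<and> 2 * H (lam k) < M k}) = UNIV"
    by auto
  finally show False using no_maj by contradiction
qed

text \<open>
  The state of the construction: the indices chosen so far and the function built for them. The
  upper bounds are strict so that on the finite set \<open>D\<close> there is room for small additions.
\<close>
definition admissible :: "(nat \<Rightarrow> complex) \<Rightarrow> (nat \<Rightarrow> real) \<Rightarrow> (nat \<Rightarrow> real) \<Rightarrow> nat set \<Rightarrow> (complex \<Rightarrow> real) \<Rightarrow> bool" where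
  "admissible lam m M D H \<longleftrightarrow> finite D \<and> H \<in> Har_pos \<and> H 0 < 1 \<and>
     (\<forall>k\<in>D. M k / m k \<le> H (lam k) \<and> H (lam k) < M k)"

text \<open>
  The new function is \<open>H + e * U\<close>, where \<open>U\<close> is a tight majorant on a new block \<open>F\<close>. It is essential
  that \<open>e\<close> can be fixed before \<open>F\<close> is chosen: \<open>U 0\<close> is at most \<open>a + C\<close> whatever the block, so Harnack's
  inequality bounds \<open>U\<close> in advance at the points of \<open>D\<close>. The block is then taken where \<open>m\<close> is at
  least \<open>1 / e\<close>, so that \<open>e * U\<close> reaches \<open>M / m\<close> there.
\<close>
lemma admissible_extend:
  assumes lam: "\<And>k. norm (lam k) < 1" and M: "\<And>k. 0 < M k" and m: "\<And>k. 0 < m k"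
    and m_lim: "filterlim m at_top sequentially"
    and growth: "\<And>k. (1 - norm (lam k)) * M k \<le> C"
    and no_maj: "\<not> has_harmonic_majorant UNIV lam M"
    and adm: "admissible lam m M D H" and "0 < a"
  shows "\<exists>D' H'. admissible lam m M D' H' \<and> D \<subseteq> D' \<and> \<not> majorant_below D' lam M a \<and>
            (\<forall>z. norm z < 1 \<longrightarrow> H z \<le> H' z)"
proof -
  have D: "finite D" and H: "H \<in> Har_pos" and H0: "H 0 < 1"
    and HD: "\<And>k. k \<in> D \<Longrightarrow> M k / m k \<le> H (lam k) \<and> H (lam k) < M k"
    using adm by (auto simp: admissible_def)
  have "0 \<le> C"
    using growth[of 0] lam[of 0] M[of 0] by (meson diff_ge_0_iff_ge less_imp_le mult_nonneg_nonneg order_trans)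
  then have "0 < a + C" using \<open>0 < a\<close> by simp
  (* Harnack's bound for a majorant whose value at the origin is less than a + C. *)
  define L where "L = (\<lambda>z::complex. (a + C) * (1 + norm z) / (1 - norm z))"
  have L: "0 < L z" if "norm z < 1" for z
    unfolding L_def using that \<open>0 < a + C\<close> norm_ge_zero[of z]
    by (intro divide_pos_pos mult_pos_pos[of "a + C"]) linarith+
  (* The three kinds of entries keep H + e * U below M on the new block, below 1 at the origin and
     below M on the old indices, in this order. *)
  define e where "e = Min (insert (1/4) (insert ((1 - H 0) / (a + C)) ((\<lambda>k. (M k - H (lam k)) / L (lam k)) ` D)))"
  have "0 < e"
    unfolding e_def using D H0 \<open>0 < a + C\<close> HD L lam by (subst Min_gr_iff) auto
  have e1: "e \<le> 1/4" and e2: "e \<le> (1 - H 0) / (a + C)"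
    and e3: "\<And>k. k \<in> D \<Longrightarrow> e \<le> (M k - H (lam k)) / L (lam k)"
    unfolding e_def using D by (intro Min_le; simp)+
  obtain F U where F: "finite F" "F \<subseteq> {k. 1 / e \<le> m k \<and> 2 * H (lam k) < M k}" "\<not> majorant_below F lam M a"
    and U: "U \<in> Har_pos" "U 0 < a + C" "\<And>k. k \<in> F \<Longrightarrow> M k \<le> U (lam k) \<and> U (lam k) \<le> 2 * M k"
    using tight_block[OF lam M growth not_has_harmonic_majorant_tail[OF lam m_lim no_maj H, of "1/e"] \<open>0 < a\<close>]
    by blast
  define H' where "H' = (\<lambda>z. H z + e * U z)"
  have le: "H z \<le> H' z" if "norm z < 1" for z
    using mult_pos_pos[OF \<open>0 < e\<close> Har_pos_gt_0[OF U(1) that]] by (simp add: H'_def)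
  have "H' \<in> Har_pos"
    unfolding H'_def by (intro Har_pos_add Har_pos_scale H U \<open>0 < e\<close>)
  moreover have "H' 0 < 1"
  proof -
    have "e * U 0 < e * (a + C)" using U(2) \<open>0 < e\<close> by simp
    also have "\<dots> \<le> 1 - H 0" using e2 \<open>0 < a + C\<close> by (simp add: field_simps)
    finally show ?thesis by (simp add: H'_def)
  qed
  moreover have "M k / m k \<le> H' (lam k) \<and> H' (lam k) < M k" if "k \<in> D" for k
  proof
    show "M k / m k \<le> H' (lam k)" using HD[OF that] le[OF lam, of k] by simp
    have "U (lam k) \<le> U 0 * (1 + norm (lam k)) / (1 - norm (lam k))"
      by (rule Harnack_upper[OF U(1) lam])
    also have "\<dots> < L (lam k)"
      unfolding L_def using U(2) lam[of k]
      by (intro divide_strict_right_mono mult_strict_right_mono) (auto intro: add_pos_nonneg)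
    finally have "e * U (lam k) < e * L (lam k)" using \<open>0 < e\<close> by simp
    also have "\<dots> \<le> M k - H (lam k)" using e3[OF that] L[OF lam, of k] by (simp add: field_simps)
    finally show "H' (lam k) < M k" by (simp add: H'_def)
  qed
  moreover have "M k / m k \<le> H' (lam k) \<and> H' (lam k) < M k" if "k \<in> F" for k
  proof
    have k: "1 / e \<le> m k" "2 * H (lam k) < M k" using F(2) that by auto
    have "M k / m k \<le> e * M k"
      using k(1) m[of k] M[of k] \<open>0 < e\<close> by (simp add: field_simps)
    also have "\<dots> \<le> e * U (lam k)" using U(3)[OF that] \<open>0 < e\<close> by simp
    also have "\<dots> \<le> H' (lam k)" using Har_pos_gt_0[OF H lam, of k] by (simp add: H'_def)
    finally show "M k / m k \<le> H' (lam k)" .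
    have "e * U (lam k) \<le> (1/4) * (2 * M k)"
      using e1 U(3)[OF that] \<open>0 < e\<close> M[of k] by (intro mult_mono) auto
    then show "H' (lam k) < M k" using k(2) by (simp add: H'_def)
  qed
  ultimately have "admissible lam m M (D \<union> F) H'"
    using D F(1) by (auto simp: admissible_def)
  moreover have "\<not> majorant_below (D \<union> F) lam M a"
    using F(3) majorant_below_subset[of "D \<union> F" lam M a F] by blast
  ultimately show ?thesis using le by blast
qed

section \<open>Passage to the limit\<close>
lemma limsup_less_infinity_imp_bounded_above:
  fixes x :: "nat \<Rightarrow> real"
  assumes "limsup (\<lambda>k. ereal (x k)) < \<infinity>"
  shows "\<exists>C. \<forall>k. x k \<le> C"
proof -
  obtain c where c: "limsup (\<lambda>k. ereal (x k)) < ereal c"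
    using assms less_PInf_Ex_of_nat by (metis ereal_dense2 )
  have "\<forall>\<^sub>F k in sequentially. ereal (x k) < ereal c"
    using Limsup_lessD[OF c] .
  then obtain N where N: "\<And>k. k \<ge> N \<Longrightarrow> x k < c"
    by (auto simp: eventually_sequentially)
  have "x k \<le> max c (Max (x ` {..N}))" for k
    using N[of k] by (cases "k \<ge> N") (auto simp: le_max_iff_disj intro!: Max_ge)
  then show ?thesis by blast
qed

theorem theoremB:
  fixes lam :: "nat \<Rightarrow> complex" and m M :: "nat \<Rightarrow> real"
  assumes disk: "\<And>k. lam k \<in> ball 0 1"
    and m_pos: "\<And>k. m k > 0"
    and M_pos: "\<And>k. M k > 0"
    and m_lim: "filterlim m at_top sequentially"
    and M_growth: "limsup (\<lambda>k. ereal ((1 - norm (lam k)) * M k)) < \<infinity>"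
    and no_maj: "\<not> has_harmonic_majorant UNIV lam M"
  shows "\<exists>r :: nat \<Rightarrow> nat. \<exists>H\<in>Har_pos. strict_mono r \<and>
           (\<forall>i. M (r i) / m (r i) \<le> H (lam (r i)) \<and> H (lam (r i)) \<le> M (r i)) \<and>
           \<not> has_harmonic_majorant UNIV (\<lambda>i. lam (r i)) (\<lambda>i. M (r i)) \<and>
           \<not> has_harmonic_majorant UNIV (\<lambda>i. lam (r i)) (\<lambda>i. m (r i) * H (lam (r i)))"
proof -
  have lam: "\<And>k. norm (lam k) < 1" using disk by simp
  obtain C where C: "\<And>k. (1 - norm (lam k)) * M k \<le> C"
    using limsup_less_infinity_imp_bounded_above[OF M_growth] by blast
  let ?A = "\<lambda>p. admissible lam m M (fst p) (snd p)"
  have "\<exists>f. \<forall>n. ?A (f n) \<and> (fst (f n) \<subseteq> fst (f (Suc n)) \<and>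
       \<not> majorant_below (fst (f (Suc n))) lam M (real (Suc n)) \<and>
       (\<forall>z. norm z < 1 \<longrightarrow> snd (f n) z \<le> snd (f (Suc n)) z))"
  proof (rule dependent_nat_choice)
    (* Any constant strictly between 0 and 1 would do. *)
    have "?A ({}, \<lambda>_. 1/2)" by (simp add: admissible_def Har_pos_const)
    then show "\<exists>x. ?A x" by blast
  next
    fix x :: "nat set \<times> (complex \<Rightarrow> real)" and n
    assume "?A x"
    from admissible_extend[OF lam M_pos m_pos m_lim C no_maj this, of "real (Suc n)"]
    obtain D' H' where "admissible lam m M D' H'" "fst x \<subseteq> D'" "\<not> majorant_below D' lam M (real (Suc n))"
      "\<forall>z. norm z < 1 \<longrightarrow> snd x z \<le> H' z"
      by auto
    then show "\<exists>y. ?A y \<and> (fst x \<subseteq> fst y \<and> \<not> majorant_below (fst y) lam M (real (Suc n)) \<and>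
       (\<forall>z. norm z < 1 \<longrightarrow> snd x z \<le> snd y z))"
      by (intro exI[of _ "(D', H')"]) simp
  qed
  then obtain f where f: "\<forall>n. ?A (f n) \<and> (fst (f n) \<subseteq> fst (f (Suc n)) \<and>
       \<not> majorant_below (fst (f (Suc n))) lam M (real (Suc n)) \<and>
       (\<forall>z. norm z < 1 \<longrightarrow> snd (f n) z \<le> snd (f (Suc n)) z))" ..
  define D where "D = (\<lambda>n. fst (f n))"
  define h where "h = (\<lambda>n. snd (f n))"
  have adm: "admissible lam m M (D n) (h n)" for n
    using f by (simp add: D_def h_def)
  have D_mono: "D i \<subseteq> D j" if "i \<le> j" for i j
    using lift_Suc_mono_le[of D, OF _ that] f by (simp add: D_def)
  have D_big: "\<not> majorant_below (D (Suc n)) lam M (real (Suc n))" for n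
    using f unfolding D_def by blast
  have h_mono: "h i z \<le> h j z" if "i \<le> j" "norm z < 1" for i j z
    using lift_Suc_mono_le[of "\<lambda>n. h n z", OF _ that(1)] f that(2) by (simp add: h_def)
  define E where "E = (\<Union>n. D n)"
  have E: "\<not> has_harmonic_majorant E lam M"
  proof
    assume "has_harmonic_majorant E lam M"
    then obtain U where U: "U \<in> Har_pos" "\<And>k. k \<in> E \<Longrightarrow> M k \<le> U (lam k)"
      by (rule has_harmonic_majorantE) (rule that)
    obtain n where "U 0 < real n" using reals_Archimedean2 by blast
    then have "majorant_below (D (Suc n)) lam M (real (Suc n))"
      using U by (intro majorant_belowI[of U]) (auto simp: E_def)
    then show False using D_big by contradiction
  qed
  then have "infinite E" using has_harmonic_majorant_finite by blast
  have h_Har: "h n \<in> Har_pos" and h_0: "h n 0 \<le> 1" for n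
    using adm[of n] by (auto simp: admissible_def)
  obtain g s where g: "g holomorphic_on ball 0 1" and s: "strict_mono (s :: nat \<Rightarrow> nat)"
    and lim: "\<And>z. norm z < 1 \<Longrightarrow> (\<lambda>n. h (s n) z) \<longlonglongrightarrow> Re (g z)"
    by (rule Har_pos_normal_family[where u = h, OF h_Har h_0]) (rule that)
  define H where "H = (\<lambda>z. Re (g z))"
  have h_le: "h n z \<le> H z" if "norm z < 1" for n z
    unfolding H_def
  proof (rule LIMSEQ_le_const[OF lim[OF that]])
    show "\<exists>N. \<forall>i\<ge>N. h n z \<le> h (s i) z"
      using h_mono[OF _ that] seq_suble[OF s] order_trans by blast
  qed
  (* The limit stays positive because it lies above every member of the increasing sequence. *)
  have "H \<in> Har_pos"
    using g h_le Har_pos_gt_0[OF h_Har] less_le_trans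
    by (intro Har_posI[of g]) (auto simp: H_def, blast)
  have HE: "M k / m k \<le> H (lam k) \<and> H (lam k) \<le> M k" if k: "k \<in> E" for k
  proof
    obtain n where n: "k \<in> D n" using k by (auto simp: E_def)
    show "M k / m k \<le> H (lam k)"
      using adm[of n] n h_le[OF lam, of n k] by (force simp: admissible_def)
    show "H (lam k) \<le> M k"
      unfolding H_def
    proof (rule LIMSEQ_le_const2[OF lim[OF lam]])
      have "h (s i) (lam k) \<le> M k" if "i \<ge> n" for i
      proof -
        have "n \<le> s i" using seq_suble[OF s, of i] that by simp
        then have "k \<in> D (s i)" using D_mono n by blast
        then show ?thesis using adm[of "s i"] by (force simp: admissible_def)
      qed
      then show "\<exists>N. \<forall>i\<ge>N. h (s i) (lam k) \<le> M k" by blast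
    qed
  qed
  define r where "r = enumerate E"
  have r: "strict_mono r" "range r = E"
    using \<open>infinite E\<close> by (auto simp: r_def strict_mono_enumerate range_enumerate)
  have no_M: "\<not> has_harmonic_majorant UNIV (\<lambda>i. lam (r i)) (\<lambda>i. M (r i))"
    using E r(2) unfolding has_harmonic_majorant_def by (metis rangeE UNIV_I)
  have H_r: "M (r i) / m (r i) \<le> H (lam (r i)) \<and> H (lam (r i)) \<le> M (r i)" for i
    using HE[of "r i"] r(2) by blast
  have "M (r i) \<le> m (r i) * H (lam (r i))" for i
    using H_r[of i] m_pos[of "r i"] by (simp add: field_simps)
  then have "\<not> has_harmonic_majorant UNIV (\<lambda>i. lam (r i)) (\<lambda>i. m (r i) * H (lam (r i)))"
    using no_M unfolding has_harmonic_majorant_def by (meson order_trans)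
  with no_M H_r r(1) \<open>H \<in> Har_pos\<close> show ?thesis by blast
qed

end
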